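(* Let $\{N_i(t),\,t\ge0\}_{i\in\mathbb{N}}$ be a family of Bell-Touchard processes with parameters $\{\alpha_i,\theta\}_{i\in\mathbb{N}}$ (that is, $\{N_i(t),\,t\ge0\}$ has parameters $(\alpha_i,\theta)$, with the same $\theta$ for all $i$), and let $\tilde N_n(t)=\sum_{i=1}^{n}N_i(t)$ for all $t\ge0$. Then $\{\tilde N_n(t),\,t\ge0\}$ is a Bell-Touchard process with parameters $(\tilde\alpha_n,\theta)$, where $\tilde\alpha_n:=\sum_{i=1}^{n}\alpha_i$.
   Context: $\mathbb{N}=\{1,2,\dots\}$, $\mathbb{N}_0=\mathbb{N}\cup\{0\}$. A counting process is a stochastic process $\{N(t),\,t\ge0\}$ where $N(t)\in\mathbb{N}_0$ represents the number of events that occur within a time interval of length $t$, namely $[0,t)$. A function $f:\mathbb{R}\to\mathbb{R}$ is $o(s)$ if $\lim_{s\to0}f(s)/s=0$. A counting process $\{N(t),\,t\ge0\}$ is a Bell-Touchard process with parameters $(\alpha,\theta)\in\mathbb{R}_+^2$ if (1) $N(0)=0$; (2) it has stationary and independent increments; (3) $\Pr[N(t+s)-N(t)=k]=\alpha s\,\theta^k/k!+o(s)$ for $k\in\mathbb{N}$ and $s,t>0$.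
   Formalization: The processes in the family are additionally assumed to be mutually independent on one probability space; without this the claim fails, e.g. if N_1 = N_2 the sum takes only even values, contradicting condition (3) for k = 1. *)

theory Defs
  imports "HOL-Probability.Probability" "HOL-Library.Landau_Symbols"
begin

text \<open>A path counts events if \<open>N t\<close> is the number of events in \<open>[0,t)\<close>. Here \<open>T j\<close> is the time of
  the \<open>j\<close>-th event, in no particular order; \<open>T j = \<infinity>\<close> means that it never happens (so a path may
  have finitely many events), and repeated times model several events at the same instant.
  Finiteness is explicit because \<open>card\<close> of an infinite set is \<open>0\<close>.\<close>

definition counts_events :: "(real \<Rightarrow> nat) \<Rightarrow> bool" where
  "counts_events p \<longleftrightarrow>
     (\<exists>T :: nat \<Rightarrow> ereal. \<forall>t\<ge>0.
        finite {j. T j \<in> {0..<ereal t}} \<and> p t = card {j. T j \<in> {0..<ereal t}})"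

text \<open>Processes are indexed by \<open>[0,\<infinity>)\<close>; values at negative times are irrelevant throughout.\<close>

definition counting_process :: "'a measure \<Rightarrow> (real \<Rightarrow> 'a \<Rightarrow> nat) \<Rightarrow> bool" where
  "counting_process M N \<longleftrightarrow>
     prob_space M \<and>
     (\<forall>t\<ge>0. N t \<in> measurable M (count_space UNIV)) \<and>
     (\<forall>\<omega>\<in>space M. counts_events (\<lambda>t. N t \<omega>))"

text \<open>Integer-valued, to avoid truncated subtraction.\<close>

definition increment :: "(real \<Rightarrow> 'a \<Rightarrow> nat) \<Rightarrow> real \<Rightarrow> real \<Rightarrow> 'a \<Rightarrow> int" where
  "increment N s t \<omega> = int (N t \<omega>) - int (N s \<omega>)"

definition stationary_increments :: "'a measure \<Rightarrow> (real \<Rightarrow> 'a \<Rightarrow> nat) \<Rightarrow> bool" where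
  "stationary_increments M N \<longleftrightarrow>
     (\<forall>t\<ge>0. \<forall>u\<ge>0. \<forall>s\<ge>0.
        distr M (count_space UNIV) (increment N t (t + s)) =
        distr M (count_space UNIV) (increment N u (u + s)))"

definition independent_increments :: "'a measure \<Rightarrow> (real \<Rightarrow> 'a \<Rightarrow> nat) \<Rightarrow> bool" where
  "independent_increments M N \<longleftrightarrow>
     (\<forall>(m::nat) (t :: nat \<Rightarrow> real). 0 \<le> t 0 \<and> strict_mono_on {..m} t \<longrightarrow>
        prob_space.indep_vars M (\<lambda>_. count_space UNIV)
          (\<lambda>i. increment N (t i) (t (Suc i))) {..<m})"

text \<open>\<open>\<real>\<^sub>+\<close> is read as the positive reals. The \<open>o(s)\<close> is taken as \<open>s\<close> tends to \<open>0\<close> from the right,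
  separately for each \<open>k\<close> and \<open>t\<close>.\<close>

definition bell_touchard_process ::
    "'a measure \<Rightarrow> (real \<Rightarrow> 'a \<Rightarrow> nat) \<Rightarrow> real \<Rightarrow> real \<Rightarrow> bool" where
  "bell_touchard_process M N \<alpha> \<theta> \<longleftrightarrow>
     \<alpha> > 0 \<and> \<theta> > 0 \<and>
     counting_process M N \<and>
     (\<forall>\<omega>\<in>space M. N 0 \<omega> = 0) \<and>
     stationary_increments M N \<and>
     independent_increments M N \<and>
     (\<forall>k\<ge>1. \<forall>t>0.
        (\<lambda>s. measure M {\<omega>\<in>space M. increment N t (t + s) \<omega> = int k} - \<alpha> * s * \<theta> ^ k / fact k)
          \<in> o[at_right 0](\<lambda>s. s))"

text \<open>Mutual independence of processes, each regarded as a random element of the path space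
  with its product \<open>\<sigma>\<close>-algebra.\<close>

definition independent_processes ::
    "'a measure \<Rightarrow> ('i \<Rightarrow> real \<Rightarrow> 'a \<Rightarrow> nat) \<Rightarrow> 'i set \<Rightarrow> bool" where
  "independent_processes M N I \<longleftrightarrow>
     prob_space.indep_vars M (\<lambda>_. \<Pi>\<^sub>M t\<in>{0..}. count_space UNIV)
       (\<lambda>i \<omega>. \<lambda>t\<in>{0..}. N i t \<omega>) I"

end

theory Submission imports Defs begin

text \<open>
  It suffices to add two processes \<open>N\<close> and \<open>N'\<close> that are independent of each other
  (\<open>bell_touchard_process_add\<close>): in the step from \<open>n\<close> to \<open>n + 1\<close>, the partial sum is a measurable
  function of the first \<open>n\<close> paths and hence independent of the next path
  (\<open>indep_var_path_sum\<close>).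

  Increments are additive in the process. The law of a sum of two independent variables depends
  only on their laws, which gives stationarity. For independence, the increments of \<open>N\<close> and those
  of \<open>N'\<close> over the same partition together form one independent family
  (\<open>indep_vars_case_sum\<close>), and the increments of \<open>N + N'\<close> are functions of disjoint pairs of its
  members.

  For the rates, let \<open>f j s\<close> and \<open>g j s\<close> be the probabilities of \<open>j\<close> events of \<open>N\<close> and of \<open>N'\<close>
  in an interval of length \<open>s\<close>. Increments are nonnegative, so the probability of \<open>k\<close> events of
  \<open>N + N'\<close> is the finite sum of the \<open>f j s * g (k - j) s\<close>. The terms with \<open>0 < j < k\<close> are products
  of two quantities of order \<open>s\<close> and hence \<open>o(s)\<close>. The two outer terms are \<open>f 0 s * g k s\<close> and
  \<open>f k s * g 0 s\<close>, and they contribute the sum of the two rates, provided that \<open>f 0\<close> and \<open>g 0\<close>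
  tend to \<open>1\<close> (\<open>convolution_first_order\<close>).

  This last fact is the delicate point. The rate condition bounds \<open>f k s\<close> for each \<open>k \<ge> 1\<close>
  separately, without uniformity in \<open>k\<close>, so it does not bound the probability \<open>1 - f 0 s\<close> of
  at least one event. The proof takes \<open>f 0 s \<rightarrow> 1\<close> from the paths
  (\<open>prob_no_increment_tendsto_1\<close>): since \<open>N t\<close> counts the events in \<open>[0,t)\<close>, paths are
  left-continuous, so with probability tending to \<open>1\<close> nothing happens in \<open>[1 - s, 1)\<close>, and
  stationarity carries this to every other interval of length \<open>s\<close>.
\<close>

section \<open>Paths of a counting process\<close>

lemma counts_events_mono:
  assumes "counts_events p" "0 \<le> s" "s \<le> t"
  shows "p s \<le> p t"
proof -
  obtain T :: "nat \<Rightarrow> ereal" where T: "\<And>t. t \<ge> 0 \<Longrightarrow> finite {j. T j \<in> {0..<ereal t}}"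
      "\<And>t. t \<ge> 0 \<Longrightarrow> p t = card {j. T j \<in> {0..<ereal t}}"
    using assms(1) unfolding counts_events_def by blast
  have "{j. T j \<in> {0..<ereal s}} \<subseteq> {j. T j \<in> {0..<ereal t}}"
    using assms(3) by (auto intro: less_le_trans)
  then show ?thesis
    using T assms(2,3) by (simp add: card_mono)
qed

lemma counts_events_add:
  assumes "counts_events p" "counts_events q"
  shows "counts_events (\<lambda>t. p t + q t)"
proof -
  obtain T :: "nat \<Rightarrow> ereal" where T: "\<And>t. t \<ge> 0 \<Longrightarrow> finite {j. T j \<in> {0..<ereal t}}"
      "\<And>t. t \<ge> 0 \<Longrightarrow> p t = card {j. T j \<in> {0..<ereal t}}"
    using assms(1) unfolding counts_events_def by blast
  obtain U :: "nat \<Rightarrow> ereal" where U: "\<And>t. t \<ge> 0 \<Longrightarrow> finite {j. U j \<in> {0..<ereal t}}"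
      "\<And>t. t \<ge> 0 \<Longrightarrow> q t = card {j. U j \<in> {0..<ereal t}}"
    using assms(2) unfolding counts_events_def by blast
  define V where "V j = (if even j then T (j div 2) else U (j div 2))" for j
  have V: "{j. V j \<in> A} = (\<lambda>j. 2 * j) ` {j. T j \<in> A} \<union> (\<lambda>j. 2 * j + 1) ` {j. U j \<in> A}" for A
  proof (rule set_eqI)
    fix j
    show "j \<in> {j. V j \<in> A} \<longleftrightarrow> j \<in> (\<lambda>j. 2 * j) ` {j. T j \<in> A} \<union> (\<lambda>j. 2 * j + 1) ` {j. U j \<in> A}"
    proof (cases "even j")
      case True
      then obtain i where "j = 2 * i" by (elim evenE)
      moreover have "2 * i \<noteq> Suc (2 * l)" for l by presburger
      ultimately show ?thesis by (auto simp: V_def image_iff)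
    next
      case False
      then obtain i where "j = 2 * i + 1" by (elim oddE)
      moreover have "Suc (2 * i) \<noteq> 2 * l" for l by presburger
      ultimately show ?thesis by (auto simp: V_def image_iff)
    qed
  qed
  have "finite {j. V j \<in> {0..<ereal t}} \<and> p t + q t = card {j. V j \<in> {0..<ereal t}}"
    if "t \<ge> 0" for t
  proof -
    have "(\<lambda>j::nat. 2 * j) ` A \<inter> (\<lambda>j. 2 * j + 1) ` B = {}" for A B
      by (auto, presburger)
    then show ?thesis
      unfolding V using T[OF that] U[OF that]
      by (subst card_Un_disjoint) (auto simp: card_image inj_on_def)
  qed
  then show ?thesis
    unfolding counts_events_def by blast
qed

text \<open>Only finitely many events fall into \<open>[0,t)\<close>, so the last of them happens before \<open>t - s\<close> once
  \<open>s\<close> is small.\<close>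

lemma counts_events_left_continuous:
  assumes "counts_events p" "0 < t"
  shows "eventually (\<lambda>s. p (t - s) = p t) (at_right 0)"
proof -
  obtain T :: "nat \<Rightarrow> ereal" where T: "\<And>t. t \<ge> 0 \<Longrightarrow> finite {j. T j \<in> {0..<ereal t}}"
      "\<And>t. t \<ge> 0 \<Longrightarrow> p t = card {j. T j \<in> {0..<ereal t}}"
    using assms(1) unfolding counts_events_def by blast
  let ?J = "{j. T j \<in> {0..<ereal t}}"
  have "eventually (\<lambda>s. T j < ereal (t - s)) (at_right 0)" if "j \<in> ?J" for j
  proof -
    from that obtain r where r: "T j = ereal r" "r < t" by (cases "T j") auto
    have "eventually (\<lambda>s. s < t - r) (at_right 0)"
      using r eventually_at_right_less[of 0] by (intro order_tendstoD[OF tendsto_ident_at]) auto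
    then show ?thesis by eventually_elim (use r in auto)
  qed
  then have "eventually (\<lambda>s. \<forall>j\<in>?J. T j < ereal (t - s)) (at_right 0)"
    using T(1)[of t] assms(2) by (intro eventually_ball_finite) auto
  moreover have "eventually (\<lambda>s. s < t) (at_right 0)"
    using assms(2) by (intro order_tendstoD[OF tendsto_ident_at]) auto
  moreover have "eventually (\<lambda>s::real. 0 < s) (at_right 0)"
    by (rule eventually_at_right_less)
  ultimately show ?thesis
  proof eventually_elim
    case (elim s)
    then have "{j. T j \<in> {0..<ereal (t - s)}} = ?J"
      by (auto elim: less_trans)
    then show ?case
      using T(2)[of t] T(2)[of "t - s"] elim by simp
  qed
qed

lemma increment_nonneg:
  assumes "counting_process M N" "0 \<le> s" "s \<le> t" "\<omega> \<in> space M"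
  shows "0 \<le> increment N s t \<omega>"
  using assms counts_events_mono unfolding counting_process_def increment_def by fastforce

lemma increment_add:
  "increment (\<lambda>t \<omega>. N t \<omega> + N' t \<omega>) s t = (\<lambda>\<omega>. increment N s t \<omega> + increment N' s t \<omega>)"
  by (auto simp: increment_def)

lemma measurable_increment:
  assumes "counting_process M N" "0 \<le> s" "0 \<le> t"
  shows "increment N s t \<in> measurable M (count_space UNIV)"
proof -
  have [measurable]: "N s \<in> measurable M (count_space UNIV)" "N t \<in> measurable M (count_space UNIV)"
    using assms by (auto simp: counting_process_def)
  show ?thesis
    unfolding increment_def [abs_def] by measurable
qed

text \<open>A path may jump right after \<open>t\<close>, namely if an event happens at \<open>t\<close> itself, so the paths alone
  do not give the limit. Stationarity replaces \<open>[t, t + s)\<close> by \<open>[1 - s, 1)\<close>. By monotonicity of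
  the paths, the events that nothing happens there grow as \<open>s\<close> decreases, and by left-continuity
  they exhaust the whole space.\<close>

lemma prob_no_increment_tendsto_1:
  assumes N: "counting_process M N" "stationary_increments M N" and "0 \<le> t"
  shows "((\<lambda>s. measure M {\<omega>\<in>space M. increment N t (t + s) \<omega> = 0}) \<longlongrightarrow> 1) (at_right 0)"
proof (rule tendsto_at_right_sequentially[of 0 1])
  interpret prob_space M using N by (simp add: counting_process_def)
  fix S :: "nat \<Rightarrow> real"
  assume S: "\<And>n. 0 < S n" "\<And>n. S n < 1" "decseq S" "S \<longlonglongrightarrow> 0"
  define A where "A n = {\<omega>\<in>space M. increment N (1 - S n) 1 \<omega> = 0}" for n
  have ce: "counts_events (\<lambda>t. N t \<omega>)" if "\<omega> \<in> space M" for \<omega>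
    using N(1) that by (auto simp: counting_process_def)
  have meas: "increment N u v -` {0} \<inter> space M \<in> sets M" if "0 \<le> u" "0 \<le> v" for u v
    using measurable_sets[OF measurable_increment[OF N(1) that]] by simp
  have A_vimage: "A n = increment N (1 - S n) 1 -` {0} \<inter> space M" for n
    unfolding A_def by auto
  have prob_eq: "prob {\<omega>\<in>space M. increment N t (t + S n) \<omega> = 0} = prob (A n)" for n
  proof -
    have "distr M (count_space UNIV) (increment N t (t + S n))
        = distr M (count_space UNIV) (increment N (1 - S n) ((1 - S n) + S n))"
      by (rule N(2)[unfolded stationary_increments_def, rule_format])
        (use \<open>0 \<le> t\<close> S(1,2)[of n] in simp_all)
    then have "measure (distr M (count_space UNIV) (increment N t (t + S n))) {0}
        = measure (distr M (count_space UNIV) (increment N (1 - S n) 1)) {0}" by simp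
    then show ?thesis
      using S(1,2)[of n] \<open>0 \<le> t\<close> unfolding A_vimage
      by (simp add: measure_distr measurable_increment[OF N(1)] vimage_def Int_def conj_commute)
  qed
  have "incseq A"
  proof (rule incseq_SucI, rule subsetI)
    fix n \<omega> assume \<omega>: "\<omega> \<in> A n"
    have "S (Suc n) \<le> S n" using S(3) by (simp add: decseq_SucD)
    then have "N (1 - S n) \<omega> \<le> N (1 - S (Suc n)) \<omega>" "N (1 - S (Suc n)) \<omega> \<le> N 1 \<omega>"
      using counts_events_mono[OF ce] \<omega> S(1)[of "Suc n"] S(2)[of n] unfolding A_def by simp_all
    then show "\<omega> \<in> A (Suc n)"
      using \<omega> by (simp add: A_def increment_def)
  qed
  moreover have "range A \<subseteq> sets M"
    unfolding A_vimage using meas S(2) by (auto simp: less_imp_le)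
  ultimately have "(\<lambda>n. prob (A n)) \<longlonglongrightarrow> prob (\<Union>n. A n)"
    by (intro finite_Lim_measure_incseq)
  also have "(\<Union>n. A n) = space M"
  proof (intro equalityI subsetI)
    fix \<omega> assume \<omega>: "\<omega> \<in> space M"
    have "filterlim S (at_right 0) sequentially"
      using S by (intro tendsto_imp_filterlim_at_right) auto
    then have "eventually (\<lambda>n. N (1 - S n) \<omega> = N 1 \<omega>) sequentially"
      using counts_events_left_continuous[OF ce[OF \<omega>], of 1] by (auto simp: filterlim_iff)
    then obtain n where "N (1 - S n) \<omega> = N 1 \<omega>"
      by (auto simp: eventually_sequentially)
    then have "\<omega> \<in> A n"
      using \<omega> by (simp add: A_def increment_def)
    then show "\<omega> \<in> (\<Union>n. A n)" by blast
  qed (auto simp: A_def)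
  finally show "(\<lambda>n. prob {\<omega>\<in>space M. increment N t (t + S n) \<omega> = 0}) \<longlonglongrightarrow> 1"
    by (simp add: prob_eq prob_space)
qed simp

section \<open>Sums of independent random variables\<close>

lemma measurable_add_count_space:
  fixes f g :: "'a \<Rightarrow> 'b :: {countable, plus}"
  assumes "f \<in> measurable M (count_space UNIV)" "g \<in> measurable M (count_space UNIV)"
  shows "(\<lambda>x. f x + g x) \<in> measurable M (count_space UNIV)"
proof -
  have "(\<lambda>(x, y). x + y :: 'b)
      \<in> measurable (count_space UNIV \<Otimes>\<^sub>M count_space UNIV) (count_space UNIV)"
    by (simp add: pair_measure_countable)
  from measurable_compose[OF measurable_Pair[OF assms] this] show ?thesis
    by simp
qed

lemma measurable_sum_count_space:
  fixes f :: "'i \<Rightarrow> 'a \<Rightarrow> 'b :: {countable, comm_monoid_add}"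
  assumes "\<And>i. i \<in> I \<Longrightarrow> f i \<in> measurable M (count_space UNIV)"
  shows "(\<lambda>x. \<Sum>i\<in>I. f i x) \<in> measurable M (count_space UNIV)"
  using assms by (induction I rule: infinite_finite_induct) (simp_all add: measurable_add_count_space)

text \<open>An event about finitely many members of the joint family is the intersection of an event
  about the \<open>X i\<close> and one about the \<open>Y j\<close>. Independence of the two tuples factors its probability
  once, and independence within each family factors both halves. One half may involve no variable
  at all; its event is then the whole space.\<close>

lemma (in prob_space) indep_vars_case_sum:
  assumes X: "indep_vars S X I" and Y: "indep_vars T Y J"
    and XY: "indep_var (PiM I S) (\<lambda>\<omega>. \<lambda>i\<in>I. X i \<omega>) (PiM J T) (\<lambda>\<omega>. \<lambda>j\<in>J. Y j \<omega>)"
  shows "indep_vars (case_sum S T) (case_sum X Y) (I <+> J)"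
  unfolding indep_vars_def2 indep_sets_def
proof (intro conjI ballI allI impI)
  have rvX: "random_variable (S i) (X i)" if "i \<in> I" for i
    using X that by (simp add: indep_vars_def)
  have rvY: "random_variable (T j) (Y j)" if "j \<in> J" for j
    using Y that by (simp add: indep_vars_def)
  show rv: "random_variable (case_sum S T k) (case_sum X Y k)" if "k \<in> I <+> J" for k
    using that rvX rvY by auto
  show "{case_sum X Y k -` A \<inter> space M |A. A \<in> sets (case_sum S T k)} \<subseteq> events"
    if "k \<in> I <+> J" for k
    using measurable_sets[OF rv[OF that]] by auto
  fix K A
  assume K: "K \<subseteq> I <+> J" "K \<noteq> {}" "finite K"
    and A: "A \<in> (\<Pi> k\<in>K. {case_sum X Y k -` A \<inter> space M |A. A \<in> sets (case_sum S T k)})"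
  then have "\<forall>k\<in>K. \<exists>B. B \<in> sets (case_sum S T k) \<and> A k = case_sum X Y k -` B \<inter> space M"
    by (auto simp: Pi_iff)
  then obtain B where B: "\<And>k. k \<in> K \<Longrightarrow> B k \<in> sets (case_sum S T k)"
      "\<And>k. k \<in> K \<Longrightarrow> A k = case_sum X Y k -` B k \<inter> space M"
    by metis
  define K1 K2 where "K1 = Inl -` K" and "K2 = Inr -` K"
  have fin: "finite K1" "finite K2"
    unfolding K1_def K2_def using K(3) by (auto intro!: finite_vimageI)
  have sub: "K1 \<subseteq> I" "K2 \<subseteq> J"
    using K(1) by (auto simp: K1_def K2_def)
  have K_eq: "K = K1 <+> K2"
  proof (rule set_eqI)
    show "k \<in> K \<longleftrightarrow> k \<in> K1 <+> K2" for k
      by (cases k) (auto simp: K1_def K2_def)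
  qed
  define U where "U = {f \<in> space (PiM I S). \<forall>i\<in>K1. f i \<in> B (Inl i)}"
  define V where "V = {f \<in> space (PiM J T). \<forall>j\<in>K2. f j \<in> B (Inr j)}"
  have BX: "B (Inl i) \<in> sets (S i)" if "i \<in> K1" for i
    using B(1)[of "Inl i"] that by (simp add: K1_def)
  have BY: "B (Inr j) \<in> sets (T j)" if "j \<in> K2" for j
    using B(1)[of "Inr j"] that by (simp add: K2_def)
  have U: "U \<in> sets (PiM I S)"
    unfolding U_def using fin(1) sub(1) BX
    by (intro sets.sets_Collect_finite_All) (auto intro!: sets_Collect_single)
  have V: "V \<in> sets (PiM J T)"
    unfolding V_def using fin(2) sub(2) BY
    by (intro sets.sets_Collect_finite_All) (auto intro!: sets_Collect_single)
  have spX: "(\<lambda>i\<in>I. X i \<omega>) \<in> space (PiM I S)" if "\<omega> \<in> space M" for \<omega>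
    using that measurable_space[OF rvX] by (auto simp: space_PiM)
  have spY: "(\<lambda>j\<in>J. Y j \<omega>) \<in> space (PiM J T)" if "\<omega> \<in> space M" for \<omega>
    using that measurable_space[OF rvY] by (auto simp: space_PiM)
  have "(\<Inter>k\<in>K. A k) = (\<lambda>\<omega>. (\<lambda>i\<in>I. X i \<omega>, \<lambda>j\<in>J. Y j \<omega>)) -` (U \<times> V) \<inter> space M"
  proof -
    have events: "\<omega> \<in> (\<Inter>k\<in>K. A k) \<longleftrightarrow>
        \<omega> \<in> space M \<and> (\<forall>i\<in>K1. X i \<omega> \<in> B (Inl i)) \<and> (\<forall>j\<in>K2. Y j \<omega> \<in> B (Inr j))" for \<omega>
      using K(2) unfolding K_eq by (auto simp: B(2)[unfolded K_eq] Plus_def ball_Un)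
    have pairs: "\<omega> \<in> (\<lambda>\<omega>. (\<lambda>i\<in>I. X i \<omega>, \<lambda>j\<in>J. Y j \<omega>)) -` (U \<times> V) \<inter> space M \<longleftrightarrow>
        \<omega> \<in> space M \<and> (\<forall>i\<in>K1. X i \<omega> \<in> B (Inl i)) \<and> (\<forall>j\<in>K2. Y j \<omega> \<in> B (Inr j))" for \<omega>
      using sub spX spY by (auto simp: U_def V_def subset_iff)
    show ?thesis
      by (rule set_eqI) (simp only: events pairs)
  qed
  then have "prob (\<Inter>k\<in>K. A k)
      = prob ((\<lambda>\<omega>. \<lambda>i\<in>I. X i \<omega>) -` U \<inter> space M) * prob ((\<lambda>\<omega>. \<lambda>j\<in>J. Y j \<omega>) -` V \<inter> space M)"
    using indep_varD[OF XY U V] by simp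
  also have "prob ((\<lambda>\<omega>. \<lambda>i\<in>I. X i \<omega>) -` U \<inter> space M) = (\<Prod>i\<in>K1. prob (A (Inl i)))"
  proof (cases "K1 = {}")
    case True
    then have "(\<lambda>\<omega>. \<lambda>i\<in>I. X i \<omega>) -` U \<inter> space M = space M"
      using spX by (auto simp: U_def)
    then show ?thesis using True by (simp add: prob_space)
  next
    case False
    then have "(\<lambda>\<omega>. \<lambda>i\<in>I. X i \<omega>) -` U \<inter> space M = (\<Inter>i\<in>K1. X i -` B (Inl i) \<inter> space M)"
      using sub spX by (auto simp: U_def subset_iff)
    then show ?thesis
      using indep_varsD[OF X False fin(1) sub(1), of "\<lambda>i. B (Inl i)"] BX B(2)
      by (simp add: K1_def)
  qed
  also have "prob ((\<lambda>\<omega>. \<lambda>j\<in>J. Y j \<omega>) -` V \<inter> space M) = (\<Prod>j\<in>K2. prob (A (Inr j)))"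
  proof (cases "K2 = {}")
    case True
    then have "(\<lambda>\<omega>. \<lambda>j\<in>J. Y j \<omega>) -` V \<inter> space M = space M"
      using spY by (auto simp: V_def)
    then show ?thesis using True by (simp add: prob_space)
  next
    case False
    then have "(\<lambda>\<omega>. \<lambda>j\<in>J. Y j \<omega>) -` V \<inter> space M = (\<Inter>j\<in>K2. Y j -` B (Inr j) \<inter> space M)"
      using sub spY by (auto simp: V_def subset_iff)
    then show ?thesis
      using indep_varsD[OF Y False fin(2) sub(2), of "\<lambda>j. B (Inr j)"] BY B(2)
      by (simp add: K2_def)
  qed
  finally show "prob (\<Inter>k\<in>K. A k) = (\<Prod>k\<in>K. prob (A k))"
    unfolding K_eq using fin by (simp add: prod.Plus)
qed

text \<open>Each sum is a function of the block \<open>{Inl i, Inr i}\<close> of the joint family, and these blocks are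
  disjoint.\<close>

lemma (in prob_space) indep_vars_pairwise_add:
  fixes X Y :: "'i \<Rightarrow> 'a \<Rightarrow> int"
  assumes X: "indep_vars (\<lambda>_. count_space UNIV) X I" and Y: "indep_vars (\<lambda>_. count_space UNIV) Y I"
    and XY: "indep_var (PiM I (\<lambda>_. count_space UNIV)) (\<lambda>\<omega>. \<lambda>i\<in>I. X i \<omega>)
                       (PiM I (\<lambda>_. count_space UNIV)) (\<lambda>\<omega>. \<lambda>i\<in>I. Y i \<omega>)"
  shows "indep_vars (\<lambda>_. count_space UNIV) (\<lambda>i \<omega>. X i \<omega> + Y i \<omega>) I"
proof -
  let ?K = "\<lambda>i. {Inl i, Inr i} :: ('i + 'i) set"
  have "case_sum (\<lambda>_. count_space UNIV) (\<lambda>_. count_space UNIV) = (\<lambda>_::'i + 'i. count_space (UNIV :: int set))"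
    by (auto split: sum.split)
  then have "indep_vars (\<lambda>_. count_space UNIV) (case_sum X Y) (I <+> I)"
    using indep_vars_case_sum[OF X Y XY] by simp
  then have "indep_vars (\<lambda>i. PiM (?K i) (\<lambda>_. count_space UNIV))
      (\<lambda>i \<omega>. restrict (\<lambda>k. case_sum X Y k \<omega>) (?K i)) I"
    by (rule indep_vars_restrict) (auto simp: disjoint_family_on_def)
  then have "indep_vars (\<lambda>_. count_space UNIV)
      (\<lambda>i \<omega>. (\<lambda>f. f (Inl i) + f (Inr i)) (restrict (\<lambda>k. case_sum X Y k \<omega>) (?K i))) I"
    by (rule indep_vars_compose2) (intro measurable_add_count_space measurable_component_singleton; simp)
  then show ?thesis by simp
qed

text \<open>The right-hand side mentions \<open>X\<close> and \<open>Y\<close> only through their laws. This is what makes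
  stationarity pass to sums.\<close>

lemma (in prob_space) distr_add_indep:
  fixes X Y :: "'a \<Rightarrow> int"
  assumes "indep_var (count_space UNIV) X (count_space UNIV) Y"
  shows "distr M (count_space UNIV) (\<lambda>\<omega>. X \<omega> + Y \<omega>) =
    distr (distr M (count_space UNIV) X \<Otimes>\<^sub>M distr M (count_space UNIV) Y) (count_space UNIV)
      (\<lambda>(x, y). x + y)"
proof -
  have X: "X \<in> measurable M (count_space UNIV)" and Y: "Y \<in> measurable M (count_space UNIV)"
    using assms by (auto simp: indep_var_distribution_eq)
  have "(\<lambda>(x, y). x + y :: int)
      \<in> measurable (count_space UNIV \<Otimes>\<^sub>M count_space UNIV) (count_space UNIV)"
    unfolding case_prod_beta by (intro measurable_add_count_space) measurable
  then show ?thesis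
    using assms X Y unfolding indep_var_distribution_eq
    by (simp add: distr_distr comp_def)
qed

lemma (in prob_space) prob_add_eq_convolution:
  fixes X Y :: "'a \<Rightarrow> int"
  assumes ind: "indep_var (count_space UNIV) X (count_space UNIV) Y"
    and nonneg: "\<And>\<omega>. \<omega> \<in> space M \<Longrightarrow> 0 \<le> X \<omega>" "\<And>\<omega>. \<omega> \<in> space M \<Longrightarrow> 0 \<le> Y \<omega>"
  shows "prob {\<omega>\<in>space M. X \<omega> + Y \<omega> = int k} =
    (\<Sum>j\<le>k. prob {\<omega>\<in>space M. X \<omega> = int j} * prob {\<omega>\<in>space M. Y \<omega> = int (k - j)})"
proof -
  have X: "X \<in> measurable M (count_space UNIV)" and Y: "Y \<in> measurable M (count_space UNIV)"
    using ind by (auto simp: indep_var_distribution_eq)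
  let ?E = "\<lambda>j. (\<lambda>\<omega>. (X \<omega>, Y \<omega>)) -` ({int j} \<times> {int (k - j)}) \<inter> space M"
  have "{\<omega>\<in>space M. X \<omega> + Y \<omega> = int k} = (\<Union>j\<le>k. ?E j)"
  proof (intro equalityI subsetI)
    fix \<omega> assume "\<omega> \<in> {\<omega>\<in>space M. X \<omega> + Y \<omega> = int k}"
    then have "\<omega> \<in> ?E (nat (X \<omega>))" "nat (X \<omega>) \<le> k"
      using nonneg[of \<omega>] by auto
    then show "\<omega> \<in> (\<Union>j\<le>k. ?E j)" by blast
  qed auto
  moreover have "?E j = (X -` {int j} \<inter> space M) \<inter> (Y -` {int (k - j)} \<inter> space M)" for j
    by auto
  then have "?E j \<in> events" for j
    using measurable_sets[OF X] measurable_sets[OF Y] by (metis sets.Int UNIV_I sets_count_space Pow_UNIV)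
  moreover have "disjoint_family_on ?E {..k}"
    by (auto simp: disjoint_family_on_def)
  ultimately have "prob {\<omega>\<in>space M. X \<omega> + Y \<omega> = int k} = (\<Sum>j\<le>k. prob (?E j))"
    by (simp only:) (intro finite_measure_finite_Union image_subsetI finite_atMost)
  also have "\<dots> = (\<Sum>j\<le>k. prob (X -` {int j} \<inter> space M) * prob (Y -` {int (k - j)} \<inter> space M))"
    by (intro sum.cong refl indep_varD[OF ind]) auto
  finally show ?thesis
    by (simp add: vimage_def Int_def conj_commute)
qed

text \<open>Seen as formal series in \<open>k\<close>, \<open>f\<close> and \<open>g\<close> are perturbations of \<open>1\<close> by \<open>s * a\<close> and \<open>s * b\<close>, and
  the first-order part of their product is \<open>s * (a + b)\<close>. The statement for a single \<open>k\<close> involves only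
  finitely many coefficients, hence no uniformity in \<open>k\<close>.\<close>

lemma convolution_first_order:
  fixes f g :: "nat \<Rightarrow> real \<Rightarrow> real"
  assumes f0: "(f 0 \<longlongrightarrow> 1) (at_right 0)" and g0: "(g 0 \<longlongrightarrow> 1) (at_right 0)"
    and f: "\<And>k. k \<ge> 1 \<Longrightarrow> (\<lambda>s. f k s - a k * s) \<in> o[at_right 0](\<lambda>s. s)"
    and g: "\<And>k. k \<ge> 1 \<Longrightarrow> (\<lambda>s. g k s - b k * s) \<in> o[at_right 0](\<lambda>s. s)"
    and k: "k \<ge> 1"
  shows "(\<lambda>s. (\<Sum>j\<le>k. f j s * g (k - j) s) - (a k + b k) * s) \<in> o[at_right 0](\<lambda>s. s)"
proof -
  let ?F = "at_right (0::real)"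
  \<comment> \<open>The terms \<open>j = 0\<close> and \<open>j = k\<close>, from
    \<open>u s * v s - c * s = u s * (v s - c * s) + (u s - 1) * (c * s)\<close>.\<close>
  have edge: "(\<lambda>s. u s * v s - c * s) \<in> o[?F](\<lambda>s. s)"
    if u: "(u \<longlongrightarrow> 1) ?F" and v: "(\<lambda>s. v s - c * s) \<in> o[?F](\<lambda>s. s)" for u v :: "real \<Rightarrow> real" and c
  proof -
    have "u \<in> O[?F](\<lambda>_. 1)"
      using u by (intro bigoI_tendsto[where c = 1]) auto
    then have "(\<lambda>s. u s * (v s - c * s)) \<in> o[?F](\<lambda>s. 1 * s)"
      using v by (rule landau_o.big_small_mult)
    moreover have "(\<lambda>s. u s - 1) \<in> o[?F](\<lambda>_. 1)"
      using tendsto_diff[OF u tendsto_const[of 1]] by (intro smalloI_tendsto) auto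
    then have "(\<lambda>s. (u s - 1) * (c * s)) \<in> o[?F](\<lambda>s. 1 * s)"
      by (rule landau_o.small_big_mult) simp
    ultimately have "(\<lambda>s. u s * (v s - c * s) + (u s - 1) * (c * s)) \<in> o[?F](\<lambda>s. s)"
      by (intro sum_in_smallo) simp_all
    then show ?thesis by (simp add: algebra_simps)
  qed
  have big: "u \<in> O[?F](\<lambda>s. s)"
    if "(\<lambda>s. u s - c * s) \<in> o[?F](\<lambda>s. s)" for u :: "real \<Rightarrow> real" and c
  proof -
    have "(\<lambda>s. (u s - c * s) + c * s) \<in> O[?F](\<lambda>s. s)"
      by (intro sum_in_bigo landau_o.small_imp_big[OF that]) simp
    moreover have "(\<lambda>s. (u s - c * s) + c * s) = u" by simp
    ultimately show ?thesis by metis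
  qed
  have id_small: "(\<lambda>s. s) \<in> o[?F](\<lambda>_. 1 :: real)"
    by (intro smalloI_tendsto) auto
  have "(\<lambda>s. f j s * g (k - j) s) \<in> o[?F](\<lambda>s. s)" if "j \<in> {1..<k}" for j
  proof -
    have "f j \<in> o[?F](\<lambda>_. 1)"
      using that by (intro landau_o.big_small_trans[OF big[OF f] id_small]) auto
    then have "(\<lambda>s. f j s * g (k - j) s) \<in> o[?F](\<lambda>s. 1 * s)"
      using that by (intro landau_o.small_big_mult big[OF g]) auto
    then show ?thesis by simp
  qed
  then have mid: "(\<lambda>s. \<Sum>j\<in>{1..<k}. f j s * g (k - j) s) \<in> o[?F](\<lambda>s. s)"
    by (rule big_sum_in_smallo)
  have "(\<lambda>s. (f 0 s * g k s - b k * s) + (g 0 s * f k s - a k * s)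
      + (\<Sum>j\<in>{1..<k}. f j s * g (k - j) s)) \<in> o[?F](\<lambda>s. s)"
    by (intro sum_in_smallo mid edge f0 g0 f g k)
  moreover have "{..k} = insert 0 (insert k {1..<k})"
    using k by auto
  ultimately show ?thesis
    using k by (simp add: algebra_simps)
qed

section \<open>Sums of independent Bell-Touchard processes\<close>

abbreviation path_space :: "(real \<Rightarrow> nat) measure" where
  "path_space \<equiv> \<Pi>\<^sub>M t\<in>{0..}. count_space UNIV"

abbreviation sample_path :: "(real \<Rightarrow> 'a \<Rightarrow> nat) \<Rightarrow> 'a \<Rightarrow> real \<Rightarrow> nat" where
  "sample_path N \<omega> \<equiv> \<lambda>t\<in>{0..}. N t \<omega>"

lemma measurable_path_increment:
  assumes "0 \<le> s" "0 \<le> t"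
  shows "(\<lambda>p. int (p t) - int (p s)) \<in> measurable path_space (count_space UNIV)"
proof -
  have [measurable]: "(\<lambda>p. p s) \<in> measurable path_space (count_space UNIV)"
    "(\<lambda>p. p t) \<in> measurable path_space (count_space UNIV)"
    using assms by (auto intro!: measurable_component_singleton)
  show ?thesis by measurable
qed

lemma (in prob_space) indep_var_increment:
  assumes "indep_var path_space (sample_path N) path_space (sample_path N')" "0 \<le> s" "0 \<le> t"
  shows "indep_var (count_space UNIV) (increment N s t) (count_space UNIV) (increment N' s t)"
proof -
  let ?d = "\<lambda>p::real \<Rightarrow> nat. int (p t) - int (p s)"
  have comp: "?d \<circ> sample_path K = increment K s t" for K :: "real \<Rightarrow> 'a \<Rightarrow> nat"
    using assms(2,3) by (auto simp: increment_def)
  have d: "?d \<in> measurable path_space (count_space UNIV)"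
    using assms(2,3) by (rule measurable_path_increment)
  show ?thesis
    using indep_var_compose[OF assms(1) d d] unfolding comp .
qed

lemma counting_process_add:
  assumes "counting_process M N" "counting_process M N'"
  shows "counting_process M (\<lambda>t \<omega>. N t \<omega> + N' t \<omega>)"
  unfolding counting_process_def
proof (intro conjI allI impI ballI)
  show "prob_space M"
    using assms(1) by (simp add: counting_process_def)
  show "(\<lambda>\<omega>. N t \<omega> + N' t \<omega>) \<in> measurable M (count_space UNIV)" if "0 \<le> t" for t
    using assms that by (intro measurable_add_count_space) (simp_all add: counting_process_def)
  show "counts_events (\<lambda>t. N t \<omega> + N' t \<omega>)" if "\<omega> \<in> space M" for \<omega>
    using assms that by (intro counts_events_add) (simp_all add: counting_process_def)
qed

lemma stationary_increments_add:
  assumes M: "prob_space M"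
    and ind: "prob_space.indep_var M path_space (sample_path N) path_space (sample_path N')"
    and N: "stationary_increments M N" and N': "stationary_increments M N'"
  shows "stationary_increments M (\<lambda>t \<omega>. N t \<omega> + N' t \<omega>)"
proof -
  interpret prob_space M by fact
  show ?thesis
    unfolding stationary_increments_def increment_add
  proof (intro allI impI)
    fix t u s :: real assume tus: "0 \<le> t" "0 \<le> u" "0 \<le> s"
    then have "distr M (count_space UNIV) (increment N t (t + s))
          = distr M (count_space UNIV) (increment N u (u + s))"
        "distr M (count_space UNIV) (increment N' t (t + s))
          = distr M (count_space UNIV) (increment N' u (u + s))"
      using N N' unfolding stationary_increments_def by blast+
    then show "distr M (count_space UNIV) (\<lambda>\<omega>. increment N t (t + s) \<omega> + increment N' t (t + s) \<omega>)
        = distr M (count_space UNIV) (\<lambda>\<omega>. increment N u (u + s) \<omega> + increment N' u (u + s) \<omega>)"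
      using tus by (simp only: distr_add_indep[OF indep_var_increment[OF ind]] add_nonneg_nonneg)
  qed
qed

lemma independent_increments_add:
  assumes M: "prob_space M"
    and ind: "prob_space.indep_var M path_space (sample_path N) path_space (sample_path N')"
    and N: "independent_increments M N" and N': "independent_increments M N'"
  shows "independent_increments M (\<lambda>t \<omega>. N t \<omega> + N' t \<omega>)"
proof -
  interpret prob_space M by fact
  show ?thesis
    unfolding independent_increments_def increment_add
  proof (intro allI impI)
    fix m :: nat and t :: "nat \<Rightarrow> real"
    assume t: "0 \<le> t 0 \<and> strict_mono_on {..m} t"
    have t_nonneg: "0 \<le> t i" if "i \<le> m" for i
    proof (cases "i = 0")
      case False
      then have "t 0 < t i" using t that by (auto intro: strict_mono_onD[of "{..m}" t])
      then show ?thesis using t by simp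
    qed (use t in simp)
    let ?D = "\<lambda>p::real \<Rightarrow> nat. \<lambda>i\<in>{..<m}. int (p (t (Suc i))) - int (p (t i))"
    have D: "?D \<in> measurable path_space (PiM {..<m} (\<lambda>_. count_space UNIV))"
      by (intro measurable_restrict measurable_path_increment t_nonneg) auto
    have comp: "?D \<circ> sample_path K = (\<lambda>\<omega>. \<lambda>i\<in>{..<m}. increment K (t i) (t (Suc i)) \<omega>)"
      for K :: "real \<Rightarrow> 'a \<Rightarrow> nat"
      using t_nonneg by (auto simp: increment_def fun_eq_iff)
    have "indep_var (PiM {..<m} (\<lambda>_. count_space UNIV)) (\<lambda>\<omega>. \<lambda>i\<in>{..<m}. increment N (t i) (t (Suc i)) \<omega>)
        (PiM {..<m} (\<lambda>_. count_space UNIV)) (\<lambda>\<omega>. \<lambda>i\<in>{..<m}. increment N' (t i) (t (Suc i)) \<omega>)"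
      using indep_var_compose[OF ind D D] unfolding comp .
    then show "indep_vars (\<lambda>_. count_space UNIV)
        (\<lambda>i \<omega>. increment N (t i) (t (Suc i)) \<omega> + increment N' (t i) (t (Suc i)) \<omega>) {..<m}"
      using N N' t unfolding independent_increments_def
      by (intro indep_vars_pairwise_add) auto
  qed
qed

text \<open>The common \<open>\<theta>\<close> is what makes the summed rates \<open>\<alpha> * \<theta> ^ k / fact k\<close> and
  \<open>\<beta> * \<theta> ^ k / fact k\<close> again of this form, for all \<open>k\<close> at once.\<close>

lemma bell_touchard_process_add:
  assumes N: "bell_touchard_process M N \<alpha> \<theta>" and N': "bell_touchard_process M N' \<beta> \<theta>"
    and ind: "prob_space.indep_var M path_space (sample_path N) path_space (sample_path N')"
  shows "bell_touchard_process M (\<lambda>t \<omega>. N t \<omega> + N' t \<omega>) (\<alpha> + \<beta>) \<theta>"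
proof -
  have cp: "counting_process M N" "counting_process M N'"
    using N N' by (simp_all add: bell_touchard_process_def)
  have si: "stationary_increments M N" "stationary_increments M N'"
    using N N' by (simp_all add: bell_touchard_process_def)
  interpret prob_space M using cp(1) by (simp add: counting_process_def)
  have rate: "(\<lambda>s. prob {\<omega>\<in>space M. increment K t (t + s) \<omega> = int k} - \<gamma> * \<theta> ^ k / fact k * s)
      \<in> o[at_right 0](\<lambda>s. s)"
    if "bell_touchard_process M K \<gamma> \<theta>" "k \<ge> 1" "t > 0" for K \<gamma> k t
  proof -
    have "\<gamma> * \<theta> ^ k / fact k * s = \<gamma> * s * \<theta> ^ k / fact k" for s
      by simp
    then show ?thesis
      using that unfolding bell_touchard_process_def by presburger
  qed
  have "(\<lambda>s. prob {\<omega>\<in>space M. increment N t (t + s) \<omega> + increment N' t (t + s) \<omega> = int k}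
      - (\<alpha> + \<beta>) * s * \<theta> ^ k / fact k) \<in> o[at_right 0](\<lambda>s. s)"
    if k: "k \<ge> 1" and t: "t > 0" for k t
  proof -
    let ?f = "\<lambda>k s. prob {\<omega>\<in>space M. increment N t (t + s) \<omega> = int k}"
    let ?g = "\<lambda>k s. prob {\<omega>\<in>space M. increment N' t (t + s) \<omega> = int k}"
    have "(\<lambda>s. (\<Sum>j\<le>k. ?f j s * ?g (k - j) s)
        - (\<alpha> * \<theta> ^ k / fact k + \<beta> * \<theta> ^ k / fact k) * s) \<in> o[at_right 0](\<lambda>s. s)"
    proof (rule convolution_first_order)
      show "(?f 0 \<longlongrightarrow> 1) (at_right 0)" "(?g 0 \<longlongrightarrow> 1) (at_right 0)"
        using prob_no_increment_tendsto_1[OF cp(1) si(1)] prob_no_increment_tendsto_1[OF cp(2) si(2)] t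
        by simp_all
    qed (use rate[OF N] rate[OF N'] k t in auto)
    moreover have "eventually (\<lambda>s.
        (\<Sum>j\<le>k. ?f j s * ?g (k - j) s) - (\<alpha> * \<theta> ^ k / fact k + \<beta> * \<theta> ^ k / fact k) * s
        = prob {\<omega>\<in>space M. increment N t (t + s) \<omega> + increment N' t (t + s) \<omega> = int k}
          - (\<alpha> + \<beta>) * s * \<theta> ^ k / fact k) (at_right 0)"
      using eventually_at_right_less[of 0]
    proof eventually_elim
      case (elim s)
      have "prob {\<omega>\<in>space M. increment N t (t + s) \<omega> + increment N' t (t + s) \<omega> = int k}
          = (\<Sum>j\<le>k. ?f j s * ?g (k - j) s)"
        using t elim
        by (intro prob_add_eq_convolution indep_var_increment ind increment_nonneg[OF cp(1)]
            increment_nonneg[OF cp(2)]) auto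
      then show ?case by (simp add: field_simps)
    qed
    ultimately show ?thesis
      by (simp add: landau_o.small.in_cong)
  qed
  then show ?thesis
    using N N' counting_process_add[OF cp] stationary_increments_add[OF prob_space_axioms ind si]
      independent_increments_add[OF prob_space_axioms ind]
    by (simp add: bell_touchard_process_def increment_add)
qed

text \<open>This passes from mutual independence of a family to the independence of two processes that
  the induction over the number of summands requires.\<close>

lemma (in prob_space) indep_var_path_sum:
  assumes ind: "indep_vars (\<lambda>_. path_space) (\<lambda>i. sample_path (N i)) I"
    and J: "finite J" "J \<subseteq> I" "i \<in> I" "i \<notin> J"
  shows "indep_var path_space (sample_path (\<lambda>t \<omega>. \<Sum>j\<in>J. N j t \<omega>)) path_space (sample_path (N i))"
proof -
  let ?S = "\<lambda>F::_ \<Rightarrow> real \<Rightarrow> nat. \<lambda>t\<in>{0..}. \<Sum>j\<in>J. F j t"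
  have coord: "(\<lambda>F. F j t) \<in> measurable (PiM J (\<lambda>_. path_space)) (count_space UNIV)"
    if "j \<in> J" "t \<in> {0..}" for j t
  proof -
    have j: "(\<lambda>F. F j) \<in> measurable (PiM J (\<lambda>_. path_space)) path_space"
      using that(1) by (rule measurable_component_singleton)
    have t: "(\<lambda>p. p t) \<in> measurable path_space (count_space UNIV)"
      using that(2) by (rule measurable_component_singleton)
    show ?thesis
      by (rule measurable_compose[OF j t])
  qed
  have S: "?S \<in> measurable (PiM J (\<lambda>_. path_space)) path_space"
    by (rule measurable_restrict) (rule measurable_sum_count_space, rule coord)
  have i: "(\<lambda>F. F i) \<in> measurable (PiM {i} (\<lambda>_. path_space)) path_space"
    by (intro measurable_component_singleton) simp
  have "indep_var (PiM J (\<lambda>_. path_space)) (\<lambda>\<omega>. \<lambda>j\<in>J. sample_path (N j) \<omega>)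
      (PiM {i} (\<lambda>_. path_space)) (\<lambda>\<omega>. \<lambda>j\<in>{i}. sample_path (N j) \<omega>)"
    using J by (intro indep_var_restrict[OF ind]) auto
  moreover have "?S \<circ> (\<lambda>\<omega>. \<lambda>j\<in>J. sample_path (N j) \<omega>) = sample_path (\<lambda>t \<omega>. \<Sum>j\<in>J. N j t \<omega>)"
    by (rule ext) (simp add: fun_eq_iff)
  moreover have "(\<lambda>F. F i) \<circ> (\<lambda>\<omega>. \<lambda>j\<in>{i}. sample_path (N j) \<omega>) = sample_path (N i)"
    by (rule ext) simp
  ultimately show ?thesis
    using indep_var_compose[OF _ S i] by metis
qed

theorem proposition3p4:
  fixes M :: "'a measure"
    and N :: "nat \<Rightarrow> real \<Rightarrow> 'a \<Rightarrow> nat"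
    and \<alpha> :: "nat \<Rightarrow> real"
    and \<theta> :: real
    and n :: nat
  assumes "\<And>i. i \<ge> 1 \<Longrightarrow> bell_touchard_process M (N i) (\<alpha> i) \<theta>"
    and "independent_processes M N {1..}"
    and "n \<ge> 1"
  shows "bell_touchard_process M (\<lambda>t \<omega>. \<Sum>i=1..n. N i t \<omega>) (\<Sum>i=1..n. \<alpha> i) \<theta>"
proof -
  interpret prob_space M
    using assms(1)[of 1] by (simp add: bell_touchard_process_def counting_process_def)
  show ?thesis
    using \<open>n \<ge> 1\<close>
  proof (induction n rule: nat_induct_at_least)
    case base
    then show ?case using assms(1)[of 1] by simp
  next
    case (Suc n)
    have "indep_var path_space (sample_path (\<lambda>t \<omega>. \<Sum>i=1..n. N i t \<omega>)) path_space (sample_path (N (Suc n)))"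
      using assms(2) unfolding independent_processes_def by (rule indep_var_path_sum) auto
    from bell_touchard_process_add[OF Suc.IH assms(1) this] show ?case
      by simp
  qed
qed

end
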